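(* Let $(X,\Phi)$ be an NAIFS of surjective continuous maps on a compact metric space $(X,d)$ without any isolated point. If $(X,\Phi)$ satisfies the specification property, then every point of $X$ is an entropy point of $(X,\Phi)$.
   Context: NAIFS: A non-autonomous iterated function system (NAIFS) of continuous maps on a compact space $X$ is a pair $(X,\Phi)$ where $\Phi=\{\Phi^{(j)}\}_{j\ge 1}$, $\Phi^{(j)}=\{\varphi_i^{(j)}:X\to X\}_{i\in I^{(j)}}$ is a collection of continuous maps and $I^{(j)}$ is a non-empty finite index set. It is of surjective maps if every $\varphi_i^{(j)}$ is surjective. For $m,n\ge1$ put $I^{m,n}:=\prod_{j=0}^{n-1}I^{(m+j)}$ and $I^{m,\infty}:=\prod_{j=m}^\infty I^{(j)}$ (finite and infinite words $w=w_mw_{m+1}\cdots$). For such a word and $k\ge 1$ (at most the length of $w$) put $\varphi_w^{m,k}:=\varphi_{w_{m+k-1}}^{(m+k-1)}\circ\cdots\circ\varphi_{w_m}^{(m)}$, $\varphi_w^{m,0}:=\mathrm{id}_X$, and $\varphi_w^{m,-k}(A):=(\varphi_w^{m,k})^{-1}(A)$ for sets $A$. Entropy: For an open cover $\mathcal A$ of $X$ and $w\in I^{1,n}$ let $\mathcal A_w^{1,n}:=\bigvee_{j=0}^{n}\varphi_w^{1,-j}(\mathcal A)$, where $\varphi_w^{1,-j}(\mathcal A)=\{\varphi_w^{1,-j}(A):A\in\mathcal A\}$ and $\bigvee_i\mathcal A_i$ is the family of all intersections $\bigcap_i A_i$ with $A_i\in\mathcal A_i$. For $Y\subseteq X$ let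 $\mathcal B|_Y=\{B\cap Y:B\in\mathcal B\}$; $\mathcal N(\cdot)$ denotes the minimal cardinality of a subcover. For non-empty $Y\subseteq X$ put $$h_{\mathrm{top}}(Y,\Phi):=\sup_{\mathcal A}\limsup_{n\to\infty}\frac1n\log\Big(\frac1{\#(I^{1,n})}\sum_{w\in I^{1,n}}\mathcal N(\mathcal A_w^{1,n}|_Y)\Big),$$ the supremum being over all open covers $\mathcal A$ of $X$ (values in $[0,\infty]$). Entropy point: $x_0\in X$ is an entropy point if $h_{\mathrm{top}}(X,\Phi)=h_{\mathrm{top}}(\mathrm{cl}(U),\Phi)$ for every open neighbourhood $U$ of $x_0$. Specification property: for every $\delta>0$ there is $N(\delta)\in\mathbb N$ such that for each $w\in I^{1,\infty}$, any $x_1,\dots,x_s\in X$ with $s\ge2$ and any integers $0=j_1\le k_1<j_2\le k_2<\cdots<j_s\le k_s$ with $j_{n+1}-k_n\ge N(\delta)$ for $n=1,\dots,s-1$, there is $x\in X$ with $d(\varphi_w^{1,i}(x),\varphi_w^{1,i}(x_m))\le\delta$ for each $1\le m\le s$ and all $j_m\le i\le k_m$. *)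

theory Defs
  imports "HOL-Analysis.Analysis"
begin

text \<open>
  The space is a compact subset \<open>X\<close> of the ambient type, with the subspace topology \<open>top_of_set X\<close>
  (and the restricted metric). A system on \<open>X\<close> is given by index sets \<open>I j\<close> and maps \<open>\<phi> j i\<close>; only the
  levels \<open>j \<ge> 1\<close> and the values of the maps on \<open>X\<close> are meaningful.
\<close>

definition naifs ::
    "'a::topological_space set \<Rightarrow> (nat \<Rightarrow> 'i set) \<Rightarrow> (nat \<Rightarrow> 'i \<Rightarrow> 'a \<Rightarrow> 'a) \<Rightarrow> bool" where
  "naifs X I \<phi> \<longleftrightarrow> compact X \<and>
     (\<forall>j\<ge>1. finite (I j) \<and> I j \<noteq> {} \<and>
       (\<forall>i\<in>I j. \<phi> j i \<in> X \<rightarrow> X \<and> continuous_on X (\<phi> j i)))"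

definition surjective_naifs ::
    "'a::topological_space set \<Rightarrow> (nat \<Rightarrow> 'i set) \<Rightarrow> (nat \<Rightarrow> 'i \<Rightarrow> 'a \<Rightarrow> 'a) \<Rightarrow> bool" where
  "surjective_naifs X I \<phi> \<longleftrightarrow> naifs X I \<phi> \<and> (\<forall>j\<ge>1. \<forall>i\<in>I j. \<phi> j i ` X = X)"

text \<open>
  A word \<open>w\<^sub>m w\<^sub>m\<^sub>+\<^sub>1 \<dots>\<close> is a function of the absolute position, extensional outside its range
  of positions, so that words correspond one-to-one to the elements of the product of the index sets.
\<close>

definition words :: "(nat \<Rightarrow> 'i set) \<Rightarrow> nat \<Rightarrow> nat \<Rightarrow> (nat \<Rightarrow> 'i) set" where
  "words I m n = (\<Pi>\<^sub>E j\<in>{m..<m+n}. I j)"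

definition inf_words :: "(nat \<Rightarrow> 'i set) \<Rightarrow> nat \<Rightarrow> (nat \<Rightarrow> 'i) set" where
  "inf_words I m = (\<Pi>\<^sub>E j\<in>{m..}. I j)"

primrec iter :: "(nat \<Rightarrow> 'i \<Rightarrow> 'a \<Rightarrow> 'a) \<Rightarrow> (nat \<Rightarrow> 'i) \<Rightarrow> nat \<Rightarrow> nat \<Rightarrow> 'a \<Rightarrow> 'a" where
  "iter \<phi> w m 0 = id"
| "iter \<phi> w m (Suc k) = \<phi> (m + k) (w (m + k)) \<circ> iter \<phi> w m k"

definition open_cover :: "'a::topological_space set \<Rightarrow> 'a set set \<Rightarrow> bool" where
  "open_cover X \<A> \<longleftrightarrow> (\<forall>A\<in>\<A>. openin (top_of_set X) A) \<and> \<Union>\<A> = X"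

definition cover_join :: "'j set \<Rightarrow> ('j \<Rightarrow> 'a set set) \<Rightarrow> 'a set set" where
  "cover_join J \<A> = {\<Inter>j\<in>J. A j | A. \<forall>j\<in>J. A j \<in> \<A> j}"

definition pullback_cover ::
    "'a set \<Rightarrow> (nat \<Rightarrow> 'i \<Rightarrow> 'a \<Rightarrow> 'a) \<Rightarrow> 'a set set \<Rightarrow> (nat \<Rightarrow> 'i) \<Rightarrow> nat \<Rightarrow> nat \<Rightarrow> 'a set set" where
  "pullback_cover X \<phi> \<A> w m j = {{x \<in> X. iter \<phi> w m j x \<in> A} | A. A \<in> \<A>}"

definition word_cover ::
    "'a set \<Rightarrow> (nat \<Rightarrow> 'i \<Rightarrow> 'a \<Rightarrow> 'a) \<Rightarrow> 'a set set \<Rightarrow> (nat \<Rightarrow> 'i) \<Rightarrow> nat \<Rightarrow> 'a set set" where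
  "word_cover X \<phi> \<A> w n = cover_join {0..n} (pullback_cover X \<phi> \<A> w 1)"

definition trace_cover :: "'a set set \<Rightarrow> 'a set \<Rightarrow> 'a set set" where
  "trace_cover \<B> Y = {B \<inter> Y | B. B \<in> \<B>}"

text \<open>
  Minimal cardinality of a subcover of a cover \<open>\<C>\<close> of \<open>Y\<close>. The infimum is taken in \<^typ>\<open>nat\<close>, hence is
  attained, provided that some finite subcover exists. This holds for the traces on \<open>Y \<subseteq> X\<close> of open
  covers of the compact space \<open>X\<close>, the only families to which it is applied below.
\<close>

definition min_subcover :: "'a set \<Rightarrow> 'a set set \<Rightarrow> nat" where
  "min_subcover Y \<C> = Inf {card \<F> | \<F>. \<F> \<subseteq> \<C> \<and> finite \<F> \<and> Y \<subseteq> \<Union>\<F>}"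

definition avg_subcover ::
    "'a set \<Rightarrow> (nat \<Rightarrow> 'i set) \<Rightarrow> (nat \<Rightarrow> 'i \<Rightarrow> 'a \<Rightarrow> 'a) \<Rightarrow> 'a set set \<Rightarrow> 'a set \<Rightarrow> nat \<Rightarrow> real" where
  "avg_subcover X I \<phi> \<A> Y n =
     1 / real (card (words I 1 n)) *
     (\<Sum>w\<in>words I 1 n. real (min_subcover Y (trace_cover (word_cover X \<phi> \<A> w n) Y)))"

definition h_top ::
    "'a::topological_space set \<Rightarrow> (nat \<Rightarrow> 'i set) \<Rightarrow> (nat \<Rightarrow> 'i \<Rightarrow> 'a \<Rightarrow> 'a) \<Rightarrow> 'a set \<Rightarrow> ereal" where
  "h_top X I \<phi> Y =
     (SUP \<A>\<in>{\<A>. open_cover X \<A>}.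
        limsup (\<lambda>n. ereal (1 / real n * ln (avg_subcover X I \<phi> \<A> Y n))))"

definition entropy_point ::
    "'a::topological_space set \<Rightarrow> (nat \<Rightarrow> 'i set) \<Rightarrow> (nat \<Rightarrow> 'i \<Rightarrow> 'a \<Rightarrow> 'a) \<Rightarrow> 'a \<Rightarrow> bool" where
  "entropy_point X I \<phi> x\<^sub>0 \<longleftrightarrow> x\<^sub>0 \<in> X \<and>
     (\<forall>U. openin (top_of_set X) U \<and> x\<^sub>0 \<in> U \<longrightarrow>
        h_top X I \<phi> X = h_top X I \<phi> (top_of_set X closure_of U))"

text \<open>
  The times \<open>j\<^sub>m\<close>, \<open>k\<^sub>m\<close> are natural numbers since they are bounded below by \<open>j\<^sub>1 = 0\<close>; points and times
  are functions of which only the values at \<open>1, \<dots>, s\<close> matter.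
\<close>

definition specification_property ::
    "'a::metric_space set \<Rightarrow> (nat \<Rightarrow> 'i set) \<Rightarrow> (nat \<Rightarrow> 'i \<Rightarrow> 'a \<Rightarrow> 'a) \<Rightarrow> bool" where
  "specification_property X I \<phi> \<longleftrightarrow>
     (\<forall>\<delta>>0. \<exists>N::nat. \<forall>w\<in>inf_words I 1. \<forall>(s::nat) (x :: nat \<Rightarrow> 'a) (j :: nat \<Rightarrow> nat) (k :: nat \<Rightarrow> nat).
        s \<ge> 2 \<and> (\<forall>m\<in>{1..s}. x m \<in> X) \<and> j 1 = 0 \<and>
        (\<forall>m\<in>{1..s}. j m \<le> k m) \<and>
        (\<forall>m\<in>{1..<s}. k m < j (m + 1) \<and> k m + N \<le> j (m + 1)) \<longrightarrow>
        (\<exists>z\<in>X. \<forall>m\<in>{1..s}. \<forall>i\<in>{j m..k m}. dist (iter \<phi> w 1 i z) (iter \<phi> w 1 i (x m)) \<le> \<delta>))"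

end

theory Submission
  imports Defs
begin

text \<open>
  The inequality \<open>h\<^sub>t\<^sub>o\<^sub>p(cl U) \<le> h\<^sub>t\<^sub>o\<^sub>p(X)\<close> is monotonicity. For the converse, apply the specification
  property to only two orbit pieces: the single time \<open>0\<close> of the orbit of a point \<open>x\<^sub>0 \<in> U\<close>, and the
  times \<open>N, \<dots>, n\<close> of the orbit of an arbitrary \<open>y \<in> X\<close>. It yields a point of \<open>U\<close> whose orbit
  \<open>\<delta>\<close>-shadows that of \<open>y\<close> from time \<open>N\<close> on, where \<open>N\<close> depends neither on \<open>n\<close> nor on the word. So
  the orbits starting in \<open>U\<close> are, up to \<open>\<delta>\<close> and up to the first \<open>N\<close> times, as rich as all orbits.

  In terms of covers: let \<open>\<A>\<close> be an open cover of \<open>X\<close> with a finite subcover of cardinality \<open>a\<close>, let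
  \<open>\<delta>\<close> be small compared with a Lebesgue number of \<open>\<A>\<close>, and let \<open>\<B>\<close> consist of balls of diameter at
  most \<open>\<delta>\<close>. Two points \<open>y, y'\<close> whose shadowing points lie in the same element of the join of \<open>\<B>\<close>
  along a word stay \<open>3\<delta>\<close>-close at the times \<open>N, \<dots>, n\<close>, so each class of such points is inside one
  element of \<open>\<A>\<close> at each of these times. The first \<open>N\<close> times are dealt with by brute force, at the
  cost of a factor \<open>a\<^sup>N\<close>; this is lemma \<open>min_subcover_word_le\<close>. A factor that is independent of \<open>n\<close>
  does not affect the exponential growth rate (lemma \<open>limsup_growth_le\<close>).
\<close>

section \<open>Minimal subcovers\<close>

lemma min_subcover_le_card:
  assumes "\<F> \<subseteq> \<C>" "finite \<F>" "Y \<subseteq> \<Union>\<F>"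
  shows "min_subcover Y \<C> \<le> card \<F>"
  unfolding min_subcover_def by (rule cInf_lower) (use assms in auto)

lemma min_subcover_attained:
  assumes "\<F> \<subseteq> \<C>" "finite \<F>" "Y \<subseteq> \<Union>\<F>"
  obtains \<G> where "\<G> \<subseteq> \<C>" "finite \<G>" "Y \<subseteq> \<Union>\<G>" "card \<G> = min_subcover Y \<C>"
proof -
  have "Inf {card \<F> |\<F>. \<F> \<subseteq> \<C> \<and> finite \<F> \<and> Y \<subseteq> \<Union>\<F>}
      \<in> {card \<F> |\<F>. \<F> \<subseteq> \<C> \<and> finite \<F> \<and> Y \<subseteq> \<Union>\<F>}"
    by (rule Inf_nat_def1) (use assms in blast)
  then show ?thesis
    using that unfolding min_subcover_def by auto
qed

lemma min_subcover_pos: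
  assumes "\<F> \<subseteq> \<C>" "finite \<F>" "Y \<subseteq> \<Union>\<F>" "Y \<noteq> {}"
  shows "min_subcover Y \<C> > 0"
proof -
  obtain \<G> where "\<G> \<subseteq> \<C>" "finite \<G>" "Y \<subseteq> \<Union>\<G>" "card \<G> = min_subcover Y \<C>"
    using min_subcover_attained assms by metis
  then show ?thesis
    using \<open>Y \<noteq> {}\<close> by (metis Sup_empty card_gt_0_iff subset_empty)
qed

lemma finite_subcover_trace:
  assumes "\<F> \<subseteq> \<C>" "finite \<F>" "X \<subseteq> \<Union>\<F>" "Y \<subseteq> X"
  shows "trace_cover \<F> Y \<subseteq> trace_cover \<C> Y" "finite (trace_cover \<F> Y)" "Y \<subseteq> \<Union>(trace_cover \<F> Y)"
  using assms unfolding trace_cover_def by (auto simp: Setcompr_eq_image)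

lemma min_subcover_trace_mono:
  assumes "\<F> \<subseteq> \<C>" "finite \<F>" "X \<subseteq> \<Union>\<F>" "Y \<subseteq> X"
  shows "min_subcover Y (trace_cover \<C> Y) \<le> min_subcover X (trace_cover \<C> X)"
proof -
  obtain \<G> where G: "\<G> \<subseteq> trace_cover \<C> X" "finite \<G>" "X \<subseteq> \<Union>\<G>"
    and card: "card \<G> = min_subcover X (trace_cover \<C> X)"
    using min_subcover_attained finite_subcover_trace[OF assms(1-3) subset_refl] by metis
  have "B \<inter> Y \<in> trace_cover \<C> Y" if "B \<in> \<G>" for B
  proof -
    obtain C where "C \<in> \<C>" "B = C \<inter> X"
      using \<open>B \<in> \<G>\<close> G(1) unfolding trace_cover_def by blast
    then show ?thesis
      using \<open>Y \<subseteq> X\<close> unfolding trace_cover_def by blast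
  qed
  then have "min_subcover Y (trace_cover \<C> Y) \<le> card ((\<lambda>B. B \<inter> Y) ` \<G>)"
    using G \<open>Y \<subseteq> X\<close> by (intro min_subcover_le_card) auto
  also have "\<dots> \<le> card \<G>"
    using G(2) by (rule card_image_le)
  finally show ?thesis
    using card by simp
qed

section \<open>Joins of a cover along a word\<close>

text \<open>
  Elements of a join are handled through their itineraries \<open>c\<close>: cylinders make the intersection of
  preimages a pointwise condition on orbits, and their number is bounded by counting itineraries.
\<close>

definition cylinder ::
    "'a set \<Rightarrow> (nat \<Rightarrow> 'i \<Rightarrow> 'a \<Rightarrow> 'a) \<Rightarrow> (nat \<Rightarrow> 'i) \<Rightarrow> nat \<Rightarrow> (nat \<Rightarrow> 'a set) \<Rightarrow> 'a set" where
  "cylinder X \<phi> w n c = {x \<in> X. \<forall>j\<le>n. iter \<phi> w 1 j x \<in> c j}"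

lemma word_cover_eq_cylinders:
  "word_cover X \<phi> \<A> w n = {cylinder X \<phi> w n c | c. \<forall>j\<le>n. c j \<in> \<A>}"
proof (intro set_eqI iffI)
  fix V assume "V \<in> word_cover X \<phi> \<A> w n"
  then obtain P where V: "V = (\<Inter>j\<in>{0..n}. P j)"
    and "\<forall>j\<in>{0..n}. P j \<in> pullback_cover X \<phi> \<A> w 1 j"
    unfolding word_cover_def cover_join_def by auto
  then have "\<forall>j\<in>{0..n}. \<exists>A. A \<in> \<A> \<and> P j = {x \<in> X. iter \<phi> w 1 j x \<in> A}"
    unfolding pullback_cover_def by auto
  then obtain c where c: "\<forall>j\<in>{0..n}. c j \<in> \<A> \<and> P j = {x \<in> X. iter \<phi> w 1 j x \<in> c j}"
    by metis
  then have "V = cylinder X \<phi> w n c"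
    unfolding V cylinder_def by fastforce
  with c show "V \<in> {cylinder X \<phi> w n c | c. \<forall>j\<le>n. c j \<in> \<A>}"
    by auto
next
  fix V assume "V \<in> {cylinder X \<phi> w n c | c. \<forall>j\<le>n. c j \<in> \<A>}"
  then obtain c where V: "V = cylinder X \<phi> w n c" and c: "\<forall>j\<le>n. c j \<in> \<A>"
    by auto
  have "V = (\<Inter>j\<in>{0..n}. {x \<in> X. iter \<phi> w 1 j x \<in> c j})"
    unfolding V cylinder_def by fastforce
  moreover have "\<forall>j\<in>{0..n}. {x \<in> X. iter \<phi> w 1 j x \<in> c j} \<in> pullback_cover X \<phi> \<A> w 1 j"
    using c unfolding pullback_cover_def by auto
  ultimately show "V \<in> word_cover X \<phi> \<A> w n"
    unfolding word_cover_def cover_join_def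
    by (intro CollectI exI[of _ "\<lambda>j. {x \<in> X. iter \<phi> w 1 j x \<in> c j}"]) simp
qed

lemma iter_in_space:
  assumes "naifs X I \<phi>" "w \<in> words I 1 n" "j \<le> n" "x \<in> X"
  shows "iter \<phi> w 1 j x \<in> X"
  using \<open>j \<le> n\<close>
proof (induction j)
  case 0
  then show ?case using \<open>x \<in> X\<close> by simp
next
  case (Suc j)
  then have "w (1 + j) \<in> I (1 + j)"
    using assms(2) unfolding words_def by (intro PiE_mem[of w "{1..<1 + n}" I]) auto
  then have "\<phi> (1 + j) (w (1 + j)) \<in> X \<rightarrow> X"
    using assms(1) unfolding naifs_def by auto
  then show ?case
    using Suc by auto
qed

lemma iter_cong:
  assumes "\<And>j. m \<le> j \<Longrightarrow> j < m + k \<Longrightarrow> w j = w' j"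
  shows "iter \<phi> w m k = iter \<phi> w' m k"
  using assms by (induction k) auto

lemma finite_words: "naifs X I \<phi> \<Longrightarrow> finite (words I 1 n)"
  unfolding words_def naifs_def by (intro finite_PiE) auto

lemma words_nonempty: "naifs X I \<phi> \<Longrightarrow> words I 1 n \<noteq> {}"
  unfolding words_def naifs_def by (auto simp: PiE_eq_empty_iff)

lemma word_extends_to_inf_word:
  assumes "naifs X I \<phi>" "w \<in> words I 1 n"
  obtains w' where "w' \<in> inf_words I 1" "\<And>j. j \<in> {1..n} \<Longrightarrow> w' j = w j"
proof
  let ?w' = "\<lambda>j\<in>{1..}. if j \<le> n then w j else (SOME i. i \<in> I j)"
  have "w j \<in> I j" if "1 \<le> j" "j \<le> n" for j
    using assms(2) that unfolding words_def by (intro PiE_mem[of w "{1..<1 + n}" I]) auto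
  moreover have "(SOME i. i \<in> I j) \<in> I j" if "1 \<le> j" for j
    using assms(1) that unfolding naifs_def by (simp add: some_in_eq)
  ultimately show "?w' \<in> inf_words I 1"
    unfolding inf_words_def by auto
  show "?w' j = w j" if "j \<in> {1..n}" for j
    using that by auto
qed

lemma open_cover_finite_subcover:
  assumes "compact X" "open_cover X \<A>"
  obtains \<F> where "\<F> \<subseteq> \<A>" "finite \<F>" "X \<subseteq> \<Union>\<F>"
  using assms compact_eq_openin_cover[of X] unfolding open_cover_def
  by (metis order_refl)

text \<open>
  A finite subcover of \<open>\<A>\<close> has only finitely many itineraries of a given length, and their cylinders
  cover \<open>X\<close>. This makes every minimal subcover that occurs in the entropy an attained minimum.
\<close>

lemma word_cover_finite_subcover:
  assumes "naifs X I \<phi>" "open_cover X \<A>" "w \<in> words I 1 n"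
  obtains \<F> where "\<F> \<subseteq> word_cover X \<phi> \<A> w n" "finite \<F>" "X \<subseteq> \<Union>\<F>"
proof -
  have "compact X"
    using assms(1) unfolding naifs_def by simp
  then obtain \<A>\<^sub>0 where A0: "\<A>\<^sub>0 \<subseteq> \<A>" "finite \<A>\<^sub>0" "X \<subseteq> \<Union>\<A>\<^sub>0"
    using assms(2) open_cover_finite_subcover by metis
  let ?\<F> = "cylinder X \<phi> w n ` ({..n} \<rightarrow>\<^sub>E \<A>\<^sub>0)"
  have "?\<F> \<subseteq> word_cover X \<phi> \<A> w n"
    unfolding word_cover_eq_cylinders using A0(1) by (auto simp: PiE_iff)
  moreover have "finite ?\<F>"
    using A0(2) by (intro finite_imageI finite_PiE) auto
  moreover have "X \<subseteq> \<Union>?\<F>"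
  proof
    fix x assume "x \<in> X"
    then have "\<forall>j\<in>{..n}. \<exists>A\<in>\<A>\<^sub>0. iter \<phi> w 1 j x \<in> A"
      using iter_in_space[OF assms(1,3)] A0(3) by blast
    then obtain c where c: "\<forall>j\<in>{..n}. c j \<in> \<A>\<^sub>0 \<and> iter \<phi> w 1 j x \<in> c j"
      by metis
    then have "restrict c {..n} \<in> {..n} \<rightarrow>\<^sub>E \<A>\<^sub>0" "x \<in> cylinder X \<phi> w n (restrict c {..n})"
      using \<open>x \<in> X\<close> unfolding cylinder_def by auto
    then show "x \<in> \<Union>?\<F>"
      by blast
  qed
  ultimately show ?thesis
    using that by blast
qed

lemma avg_subcover_pos:
  assumes "naifs X I \<phi>" "open_cover X \<A>" "Y \<subseteq> X" "Y \<noteq> {}"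
  shows "avg_subcover X I \<phi> \<A> Y n > 0"
proof -
  have "min_subcover Y (trace_cover (word_cover X \<phi> \<A> w n) Y) > 0" if w: "w \<in> words I 1 n" for w
  proof -
    obtain \<F> where "\<F> \<subseteq> word_cover X \<phi> \<A> w n" "finite \<F>" "X \<subseteq> \<Union>\<F>"
      using word_cover_finite_subcover[OF assms(1,2) w] .
    from finite_subcover_trace[OF this assms(3)] show ?thesis
      using assms(4) by (rule min_subcover_pos)
  qed
  then have "(\<Sum>w\<in>words I 1 n. real (min_subcover Y (trace_cover (word_cover X \<phi> \<A> w n) Y))) > 0"
    using finite_words[OF assms(1)] words_nonempty[OF assms(1)] by (intro sum_pos) auto
  moreover have "card (words I 1 n) > 0"
    using finite_words[OF assms(1)] words_nonempty[OF assms(1)] by (simp add: card_gt_0_iff)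
  ultimately show ?thesis
    unfolding avg_subcover_def by simp
qed

lemma avg_subcover_le:
  assumes "\<And>w. w \<in> words I 1 n \<Longrightarrow>
    real (min_subcover Y (trace_cover (word_cover X \<phi> \<A> w n) Y))
      \<le> C * real (min_subcover Z (trace_cover (word_cover X \<phi> \<B> w n) Z))"
  shows "avg_subcover X I \<phi> \<A> Y n \<le> C * avg_subcover X I \<phi> \<B> Z n"
proof -
  have "(\<Sum>w\<in>words I 1 n. real (min_subcover Y (trace_cover (word_cover X \<phi> \<A> w n) Y)))
      \<le> C * (\<Sum>w\<in>words I 1 n. real (min_subcover Z (trace_cover (word_cover X \<phi> \<B> w n) Z)))"
    unfolding sum_distrib_left using assms by (rule sum_mono)
  from mult_left_mono[OF this, of "1 / real (card (words I 1 n))"] show ?thesis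
    unfolding avg_subcover_def by (simp add: mult.left_commute)
qed

section \<open>Exponential growth rates and monotonicity of the entropy\<close>

lemma limsup_growth_le:
  fixes u v :: "nat \<Rightarrow> real"
  assumes "\<And>n. u n > 0" "\<And>n. v n > 0" "C > 0"
    and "eventually (\<lambda>n. u n \<le> C * v n) sequentially"
  shows "limsup (\<lambda>n. ereal (1 / real n * ln (u n))) \<le> limsup (\<lambda>n. ereal (1 / real n * ln (v n)))"
proof -
  have "eventually (\<lambda>n. ereal (1 / real n * ln (u n))
      \<le> ereal (ln C / real n) + ereal (1 / real n * ln (v n))) sequentially"
    using assms(4)
  proof eventually_elim
    case (elim n)
    have "ln (u n) \<le> ln (C * v n)"
      using elim assms(1)[of n] by simp
    also have "\<dots> = ln C + ln (v n)"
      using assms(2)[of n] \<open>C > 0\<close> by (simp add: ln_mult)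
    finally have "1 / real n * ln (u n) \<le> 1 / real n * (ln C + ln (v n))"
      by (intro mult_left_mono) auto
    then show ?case
      by (simp add: algebra_simps add_divide_distrib)
  qed
  then have "limsup (\<lambda>n. ereal (1 / real n * ln (u n)))
      \<le> limsup (\<lambda>n. ereal (ln C / real n) + ereal (1 / real n * ln (v n)))"
    by (rule Limsup_mono)
  also have "\<dots> = 0 + limsup (\<lambda>n. ereal (1 / real n * ln (v n)))"
  proof (rule ereal_limsup_lim_add)
    have "(\<lambda>n. ln C / real n) \<longlonglongrightarrow> 0"
      by (rule lim_const_over_n)
    then show "(\<lambda>n. ereal (ln C / real n)) \<longlonglongrightarrow> 0"
      by (simp add: zero_ereal_def)
  qed simp
  finally show ?thesis
    by simp
qed

lemma h_top_mono:
  assumes "naifs X I \<phi>" "Y \<subseteq> X" "Y \<noteq> {}"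
  shows "h_top X I \<phi> Y \<le> h_top X I \<phi> X"
  unfolding h_top_def
proof (rule SUP_mono)
  fix \<A> assume "\<A> \<in> {\<A>. open_cover X \<A>}"
  then have A: "open_cover X \<A>"
    by simp
  have "avg_subcover X I \<phi> \<A> Y n \<le> 1 * avg_subcover X I \<phi> \<A> X n" for n
  proof (rule avg_subcover_le)
    fix w assume w: "w \<in> words I 1 n"
    obtain \<F> where "\<F> \<subseteq> word_cover X \<phi> \<A> w n" "finite \<F>" "X \<subseteq> \<Union>\<F>"
      using word_cover_finite_subcover[OF assms(1) A w] .
    from min_subcover_trace_mono[OF this assms(2)]
    show "real (min_subcover Y (trace_cover (word_cover X \<phi> \<A> w n) Y))
        \<le> 1 * real (min_subcover X (trace_cover (word_cover X \<phi> \<A> w n) X))"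
      by simp
  qed
  then have "limsup (\<lambda>n. ereal (1 / real n * ln (avg_subcover X I \<phi> \<A> Y n)))
      \<le> limsup (\<lambda>n. ereal (1 / real n * ln (avg_subcover X I \<phi> \<A> X n)))"
    using assms by (intro limsup_growth_le[where C = 1] avg_subcover_pos A always_eventually) auto
  with A show "\<exists>\<B>\<in>{\<A>. open_cover X \<A>}.
      limsup (\<lambda>n. ereal (1 / real n * ln (avg_subcover X I \<phi> \<A> Y n)))
      \<le> limsup (\<lambda>n. ereal (1 / real n * ln (avg_subcover X I \<phi> \<B> X n)))"
    by blast
qed

section \<open>Transfer of itineraries by shadowing\<close>

lemma open_cover_Lebesgue_number:
  fixes X :: "'a::metric_space set"
  assumes "compact X" "X \<noteq> {}" "open_cover X \<A>"
  obtains \<epsilon> where "\<epsilon> > 0" "\<And>T. T \<subseteq> X \<Longrightarrow> diameter T < \<epsilon> \<Longrightarrow> \<exists>A\<in>\<A>. T \<subseteq> A"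
proof -
  let ?\<C> = "{G. open G \<and> X \<inter> G \<in> \<A>}"
  have cover: "X \<subseteq> \<Union>?\<C>"
  proof
    fix x assume "x \<in> X"
    then obtain A where "A \<in> \<A>" "x \<in> A" "openin (top_of_set X) A"
      using assms(3) unfolding open_cover_def by auto
    then show "x \<in> \<Union>?\<C>"
      unfolding openin_open by auto
  qed
  moreover have "?\<C> \<noteq> {}"
    using cover \<open>X \<noteq> {}\<close> by fastforce
  ultimately obtain \<epsilon> where "\<epsilon> > 0" and \<epsilon>: "\<And>T. T \<subseteq> X \<Longrightarrow> diameter T < \<epsilon> \<Longrightarrow> \<exists>G\<in>?\<C>. T \<subseteq> G"
    using Lebesgue_number_lemma[OF \<open>compact X\<close> _ cover] by (metis (lifting) mem_Collect_eq)
  have "\<exists>A\<in>\<A>. T \<subseteq> A" if T: "T \<subseteq> X" "diameter T < \<epsilon>" for T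
  proof -
    obtain G where "X \<inter> G \<in> \<A>" "T \<subseteq> G"
      using \<epsilon>[OF T] by auto
    then show ?thesis
      using T(1) by (intro bexI[of _ "X \<inter> G"]) auto
  qed
  with \<open>\<epsilon> > 0\<close> show ?thesis
    using that by blast
qed

text \<open>
  The two-piece case of specification: the pieces are the single time \<open>0\<close> for \<open>x\<^sub>0\<close> and the times
  \<open>N, \<dots>, n\<close> for \<open>y\<close>. What matters is that \<open>N\<close> is uniform in the word and in the length \<open>n\<close>.
\<close>

lemma specification_shadowing_near_point:
  assumes "naifs X I \<phi>" "specification_property X I \<phi>" "\<delta> > 0"
  obtains N where "\<And>n w x\<^sub>0 y. N \<le> n \<Longrightarrow> w \<in> words I 1 n \<Longrightarrow> x\<^sub>0 \<in> X \<Longrightarrow> y \<in> X \<Longrightarrow>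
    \<exists>z\<in>X. dist z x\<^sub>0 \<le> \<delta> \<and> (\<forall>i\<in>{N..n}. dist (iter \<phi> w 1 i z) (iter \<phi> w 1 i y) \<le> \<delta>)"
proof -
  from assms(2)[unfolded specification_property_def, THEN spec, THEN mp, OF assms(3)]
  obtain N where N: "\<forall>w\<in>inf_words I 1. \<forall>s (x :: nat \<Rightarrow> 'a) (j :: nat \<Rightarrow> nat) k.
        s \<ge> (2::nat) \<and> (\<forall>m\<in>{1..s}. x m \<in> X) \<and> j 1 = 0 \<and>
        (\<forall>m\<in>{1..s}. j m \<le> k m) \<and>
        (\<forall>m\<in>{1..<s}. k m < j (m + 1) \<and> k m + N \<le> j (m + 1)) \<longrightarrow>
        (\<exists>z\<in>X. \<forall>m\<in>{1..s}. \<forall>i\<in>{j m..k m}. dist (iter \<phi> w 1 i z) (iter \<phi> w 1 i (x m)) \<le> \<delta>)" ..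
  show ?thesis
  proof
    (* The second piece has to start strictly after time 0, even if N = 0. *)
    fix n w x\<^sub>0 y
    assume n: "max N 1 \<le> n" and w: "w \<in> words I 1 n" and "x\<^sub>0 \<in> X" "y \<in> X"
    obtain w' where w': "w' \<in> inf_words I 1" "\<And>j. j \<in> {1..n} \<Longrightarrow> w' j = w j"
      using word_extends_to_inf_word[OF assms(1) w] by blast
    have iter: "iter \<phi> w' 1 i = iter \<phi> w 1 i" if "i \<le> n" for i
      using that w'(2) by (intro iter_cong) auto
    have two: "{1..2} = {1, 2::nat}" "{1..<2} = {1::nat}"
      by auto
    have "\<exists>z\<in>X. \<forall>m\<in>{1..2}. \<forall>i\<in>{(\<lambda>m. if m = 1 then 0 else max N 1) m..(\<lambda>m. if m = 1 then 0 else n) m}.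
        dist (iter \<phi> w' 1 i z) (iter \<phi> w' 1 i ((\<lambda>m. if m = (1::nat) then x\<^sub>0 else y) m)) \<le> \<delta>"
      by (rule N[rule_format, OF w'(1)]) (use n \<open>x\<^sub>0 \<in> X\<close> \<open>y \<in> X\<close> in \<open>auto simp: two\<close>)
    then obtain z where "z \<in> X" "dist z x\<^sub>0 \<le> \<delta>"
      and "\<forall>i\<in>{max N 1..n}. dist (iter \<phi> w' 1 i z) (iter \<phi> w' 1 i y) \<le> \<delta>"
      unfolding two by auto
    then show "\<exists>z\<in>X. dist z x\<^sub>0 \<le> \<delta> \<and>
        (\<forall>i\<in>{max N 1..n}. dist (iter \<phi> w 1 i z) (iter \<phi> w 1 i y) \<le> \<delta>)"
      using iter by auto
  qed
qed

text \<open>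
  Take an optimal subcover of \<open>Y\<close> by joins of \<open>\<B>\<close>, and group the points \<open>y\<close> of \<open>X\<close> by the element
  \<open>V\<close> of it that contains the chosen point \<open>z y\<close> shadowing \<open>y\<close>. The group of \<open>V\<close> has diameter at most
  \<open>\<delta> + \<delta> + \<delta>\<close> at each time \<open>i \<ge> N\<close>, hence lies in one element of \<open>\<A>\<close>; only the first \<open>N\<close> entries of an
  itinerary in \<open>\<A>\<close> remain free.
\<close>

lemma min_subcover_word_le:
  fixes X :: "'a::metric_space set"
  assumes naifs: "naifs X I \<phi>" and w: "w \<in> words I 1 n" and "N \<le> n"
    and A0: "\<A>\<^sub>0 \<subseteq> \<A>" "finite \<A>\<^sub>0" "X \<subseteq> \<Union>\<A>\<^sub>0"
    and Lebesgue: "\<And>T. T \<subseteq> X \<Longrightarrow> diameter T \<le> 3 * \<delta> \<Longrightarrow> \<exists>A\<in>\<A>. T \<subseteq> A"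
    and B: "open_cover X \<B>" "\<And>B x y. B \<in> \<B> \<Longrightarrow> x \<in> B \<Longrightarrow> y \<in> B \<Longrightarrow> dist x y \<le> \<delta>"
    and "\<delta> > 0" and "Y \<subseteq> X"
    and shadow: "\<And>y. y \<in> X \<Longrightarrow>
      \<exists>z\<in>Y. \<forall>i\<in>{N..n}. dist (iter \<phi> w 1 i z) (iter \<phi> w 1 i y) \<le> \<delta>"
  shows "min_subcover X (trace_cover (word_cover X \<phi> \<A> w n) X)
    \<le> card \<A>\<^sub>0 ^ N * min_subcover Y (trace_cover (word_cover X \<phi> \<B> w n) Y)"
proof -
  obtain z where z: "\<And>y. y \<in> X \<Longrightarrow> z y \<in> Y"
    and z_shadow: "\<And>y i. y \<in> X \<Longrightarrow> i \<in> {N..n} \<Longrightarrow> dist (iter \<phi> w 1 i (z y)) (iter \<phi> w 1 i y) \<le> \<delta>"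
    using shadow by metis
  obtain \<F>\<^sub>0 where "\<F>\<^sub>0 \<subseteq> word_cover X \<phi> \<B> w n" "finite \<F>\<^sub>0" "X \<subseteq> \<Union>\<F>\<^sub>0"
    using word_cover_finite_subcover[OF naifs B(1) w] .
  from finite_subcover_trace[OF this \<open>Y \<subseteq> X\<close>]
  obtain \<F> where F: "\<F> \<subseteq> trace_cover (word_cover X \<phi> \<B> w n) Y" "finite \<F>" "Y \<subseteq> \<Union>\<F>"
    and card_F: "card \<F> = min_subcover Y (trace_cover (word_cover X \<phi> \<B> w n) Y)"
    by (rule min_subcover_attained)
  define T where "T V = {y \<in> X. z y \<in> V}" for V
  have "\<exists>A\<in>\<A>. iter \<phi> w 1 i ` T V \<subseteq> A" if V: "V \<in> \<F>" and i: "i \<in> {N..n}" for V i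
  proof (rule Lebesgue)
    show "iter \<phi> w 1 i ` T V \<subseteq> X"
      using iter_in_space[OF naifs w] i unfolding T_def by auto
    obtain c where c: "\<And>j. j \<le> n \<Longrightarrow> c j \<in> \<B>" and V_sub: "V \<subseteq> cylinder X \<phi> w n c"
      using V F(1) unfolding trace_cover_def word_cover_eq_cylinders by blast
    have "dist (iter \<phi> w 1 i y) (iter \<phi> w 1 i y') \<le> 3 * \<delta>" if "y \<in> T V" "y' \<in> T V" for y y'
    proof -
      have "iter \<phi> w 1 i (z y) \<in> c i" "iter \<phi> w 1 i (z y') \<in> c i"
        using that V_sub i unfolding T_def cylinder_def by auto
      then have "dist (iter \<phi> w 1 i (z y)) (iter \<phi> w 1 i (z y')) \<le> \<delta>"
        using B(2)[OF c] i by auto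
      moreover have "dist (iter \<phi> w 1 i y) (iter \<phi> w 1 i (z y)) \<le> \<delta>"
        "dist (iter \<phi> w 1 i (z y')) (iter \<phi> w 1 i y') \<le> \<delta>"
        using that z_shadow i unfolding T_def by (auto simp: dist_commute)
      ultimately show ?thesis
        using dist_triangle[of "iter \<phi> w 1 i y" "iter \<phi> w 1 i y'" "iter \<phi> w 1 i (z y)"]
          dist_triangle[of "iter \<phi> w 1 i (z y)" "iter \<phi> w 1 i y'" "iter \<phi> w 1 i (z y')"]
        by linarith
    qed
    then show "diameter (iter \<phi> w 1 i ` T V) \<le> 3 * \<delta>"
      unfolding diameter_def using \<open>\<delta> > 0\<close> by (auto intro!: cSUP_least)
  qed
  then obtain a where a: "\<And>V i. V \<in> \<F> \<Longrightarrow> i \<in> {N..n} \<Longrightarrow> a V i \<in> \<A> \<and> iter \<phi> w 1 i ` T V \<subseteq> a V i"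
    by metis
  define H where "H = (\<lambda>(V, g). cylinder X \<phi> w n (\<lambda>j. if j < N then g j else a V j))"
  define P where "P = \<F> \<times> ({..<N} \<rightarrow>\<^sub>E \<A>\<^sub>0)"
  have "finite P"
    unfolding P_def using F(2) A0(2) by (intro finite_cartesian_product finite_PiE) auto
  have "min_subcover X (trace_cover (word_cover X \<phi> \<A> w n) X) \<le> card (H ` P)"
  proof (rule min_subcover_le_card)
    show "H ` P \<subseteq> trace_cover (word_cover X \<phi> \<A> w n) X"
    proof
      fix S assume "S \<in> H ` P"
      then obtain V g where V: "V \<in> \<F>" and g: "g \<in> {..<N} \<rightarrow>\<^sub>E \<A>\<^sub>0"
        and S: "S = cylinder X \<phi> w n (\<lambda>j. if j < N then g j else a V j)"
        unfolding P_def H_def by auto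
      have "(if j < N then g j else a V j) \<in> \<A>" if "j \<le> n" for j
        using PiE_mem[OF g, of j] a[OF V, of j] A0(1) that by auto
      then have "S \<in> word_cover X \<phi> \<A> w n"
        unfolding word_cover_eq_cylinders S
        by (intro CollectI exI[of _ "\<lambda>j. if j < N then g j else a V j"]) auto
      moreover have "S = S \<inter> X"
        unfolding S cylinder_def by auto
      ultimately show "S \<in> trace_cover (word_cover X \<phi> \<A> w n) X"
        unfolding trace_cover_def by blast
    qed
    show "finite (H ` P)"
      using \<open>finite P\<close> by simp
    show "X \<subseteq> \<Union>(H ` P)"
    proof
      fix y assume y: "y \<in> X"
      then obtain V where V: "V \<in> \<F>" "z y \<in> V"
        using z F(3) by blast
      have "\<forall>j\<in>{..<N}. \<exists>A\<in>\<A>\<^sub>0. iter \<phi> w 1 j y \<in> A"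
        using iter_in_space[OF naifs w _ y] A0(3) \<open>N \<le> n\<close>
        by (metis UnionE in_mono lessThan_iff nle_le order_less_le_trans order_less_imp_le)
      then obtain g where g: "\<forall>j\<in>{..<N}. g j \<in> \<A>\<^sub>0 \<and> iter \<phi> w 1 j y \<in> g j"
        by metis
      have "y \<in> T V"
        using y V unfolding T_def by simp
      then have "iter \<phi> w 1 j y \<in> a V j" if "N \<le> j" "j \<le> n" for j
        using a[OF V(1), of j] that by auto
      then have "y \<in> H (V, restrict g {..<N})"
        using y g unfolding H_def cylinder_def by auto
      moreover have "(V, restrict g {..<N}) \<in> P"
        using V(1) g unfolding P_def by auto
      ultimately show "y \<in> \<Union>(H ` P)"
        by blast
    qed
  qed
  also have "\<dots> \<le> card P"
    using \<open>finite P\<close> by (rule card_image_le)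
  also have "\<dots> = card \<A>\<^sub>0 ^ N * card \<F>"
    unfolding P_def by (simp add: card_cartesian_product card_PiE)
  finally show ?thesis
    unfolding card_F .
qed

text \<open>
  For each cover \<open>\<A>\<close> there is a finer cover \<open>\<B>\<close>, by small balls, whose growth rate on \<open>Y\<close> dominates
  that of \<open>\<A>\<close> on \<open>X\<close>; the shadowing points can be found in \<open>Y\<close> as soon as \<open>\<delta>\<close> is at most the radius
  of a ball around a point \<open>x\<^sub>0\<close> contained in \<open>Y\<close>.
\<close>

lemma h_top_le_near_point:
  fixes X :: "'a::metric_space set"
  assumes naifs: "naifs X I \<phi>" and spec: "specification_property X I \<phi>"
    and "x\<^sub>0 \<in> X" "r > 0" "X \<inter> cball x\<^sub>0 r \<subseteq> Y" "Y \<subseteq> X"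
  shows "h_top X I \<phi> X \<le> h_top X I \<phi> Y"
  unfolding h_top_def
proof (rule SUP_mono)
  fix \<A> assume "\<A> \<in> {\<A>. open_cover X \<A>}"
  then have A: "open_cover X \<A>"
    by simp
  have "compact X" "X \<noteq> {}"
    using naifs \<open>x\<^sub>0 \<in> X\<close> unfolding naifs_def by auto
  have "Y \<noteq> {}"
    using \<open>x\<^sub>0 \<in> X\<close> \<open>r > 0\<close> \<open>X \<inter> cball x\<^sub>0 r \<subseteq> Y\<close> by auto
  obtain \<epsilon> where "\<epsilon> > 0" and \<epsilon>: "\<And>T. T \<subseteq> X \<Longrightarrow> diameter T < \<epsilon> \<Longrightarrow> \<exists>A\<in>\<A>. T \<subseteq> A"
    using open_cover_Lebesgue_number[OF \<open>compact X\<close> \<open>X \<noteq> {}\<close> A] by blast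
  define \<delta> where "\<delta> = min r (\<epsilon> / 4)"
  have \<delta>: "\<delta> > 0" "\<delta> \<le> r" "3 * \<delta> < \<epsilon>"
    unfolding \<delta>_def using \<open>r > 0\<close> \<open>\<epsilon> > 0\<close> by auto
  obtain N where N: "\<And>n w x\<^sub>0 y. N \<le> n \<Longrightarrow> w \<in> words I 1 n \<Longrightarrow> x\<^sub>0 \<in> X \<Longrightarrow> y \<in> X \<Longrightarrow>
    \<exists>z\<in>X. dist z x\<^sub>0 \<le> \<delta> \<and> (\<forall>i\<in>{N..n}. dist (iter \<phi> w 1 i z) (iter \<phi> w 1 i y) \<le> \<delta>)"
    using specification_shadowing_near_point[OF naifs spec \<delta>(1)] by blast
  obtain \<A>\<^sub>0 where A0: "\<A>\<^sub>0 \<subseteq> \<A>" "finite \<A>\<^sub>0" "X \<subseteq> \<Union>\<A>\<^sub>0"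
    using open_cover_finite_subcover[OF \<open>compact X\<close> A] .
  have "card \<A>\<^sub>0 > 0"
    using A0(2,3) \<open>X \<noteq> {}\<close> by (auto simp: card_gt_0_iff)
  define \<B> where "\<B> = (\<lambda>x. X \<inter> ball x (\<delta> / 2)) ` X"
  have B: "open_cover X \<B>"
    unfolding open_cover_def \<B>_def using \<delta>(1) by auto
  have B_small: "dist x y \<le> \<delta>" if "B \<in> \<B>" "x \<in> B" "y \<in> B" for B x y
  proof -
    obtain p where "x \<in> ball p (\<delta> / 2)" "y \<in> ball p (\<delta> / 2)"
      using \<open>B \<in> \<B>\<close> \<open>x \<in> B\<close> \<open>y \<in> B\<close> unfolding \<B>_def by blast
    then show ?thesis
      using dist_triangle3[of x y p] by simp
  qed
  have "avg_subcover X I \<phi> \<A> X n \<le> real (card \<A>\<^sub>0 ^ N) * avg_subcover X I \<phi> \<B> Y n" if n: "n \<ge> N" for n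
  proof (rule avg_subcover_le)
    fix w assume w: "w \<in> words I 1 n"
    have "min_subcover X (trace_cover (word_cover X \<phi> \<A> w n) X)
        \<le> card \<A>\<^sub>0 ^ N * min_subcover Y (trace_cover (word_cover X \<phi> \<B> w n) Y)"
    proof (rule min_subcover_word_le[OF naifs w n A0 _ B B_small \<delta>(1) \<open>Y \<subseteq> X\<close>])
      show "\<exists>A\<in>\<A>. T \<subseteq> A" if "T \<subseteq> X" "diameter T \<le> 3 * \<delta>" for T
        using \<epsilon>[of T] that \<delta>(3) by auto
      show "\<exists>z\<in>Y. \<forall>i\<in>{N..n}. dist (iter \<phi> w 1 i z) (iter \<phi> w 1 i y) \<le> \<delta>" if y: "y \<in> X" for y
      proof -
        obtain z where "z \<in> X" "dist z x\<^sub>0 \<le> \<delta>"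
          and z: "\<forall>i\<in>{N..n}. dist (iter \<phi> w 1 i z) (iter \<phi> w 1 i y) \<le> \<delta>"
          using N[OF n w \<open>x\<^sub>0 \<in> X\<close> y] by blast
        then have "z \<in> Y"
          using \<open>X \<inter> cball x\<^sub>0 r \<subseteq> Y\<close> \<delta>(2) by (auto simp: dist_commute)
        with z show ?thesis
          by blast
      qed
    qed
    then show "real (min_subcover X (trace_cover (word_cover X \<phi> \<A> w n) X))
        \<le> real (card \<A>\<^sub>0 ^ N) * real (min_subcover Y (trace_cover (word_cover X \<phi> \<B> w n) Y))"
      by (metis of_nat_le_iff of_nat_mult)
  qed
  then have "eventually (\<lambda>n. avg_subcover X I \<phi> \<A> X n
      \<le> real (card \<A>\<^sub>0 ^ N) * avg_subcover X I \<phi> \<B> Y n) sequentially"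
    by (rule eventually_sequentiallyI)
  then have "limsup (\<lambda>n. ereal (1 / real n * ln (avg_subcover X I \<phi> \<A> X n)))
      \<le> limsup (\<lambda>n. ereal (1 / real n * ln (avg_subcover X I \<phi> \<B> Y n)))"
    using \<open>card \<A>\<^sub>0 > 0\<close> \<open>X \<noteq> {}\<close> \<open>Y \<noteq> {}\<close> \<open>Y \<subseteq> X\<close>
    by (intro limsup_growth_le[where C = "real (card \<A>\<^sub>0 ^ N)"] avg_subcover_pos naifs A B) auto
  with B show "\<exists>\<B>\<in>{\<A>. open_cover X \<A>}.
      limsup (\<lambda>n. ereal (1 / real n * ln (avg_subcover X I \<phi> \<A> X n)))
      \<le> limsup (\<lambda>n. ereal (1 / real n * ln (avg_subcover X I \<phi> \<B> Y n)))"
    by blast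
qed

section \<open>Entropy points\<close>

theorem theorem4p3:
  fixes X :: "'a::metric_space set"
    and I :: "nat \<Rightarrow> 'i set"
    and \<phi> :: "nat \<Rightarrow> 'i \<Rightarrow> 'a \<Rightarrow> 'a"
  assumes "surjective_naifs X I \<phi>"
    and "\<forall>x\<in>X. \<not> x isolated_in X"
    and "specification_property X I \<phi>"
  shows "\<forall>x\<in>X. entropy_point X I \<phi> x"
proof
  fix x assume "x \<in> X"
  have naifs: "naifs X I \<phi>"
    using assms(1) unfolding surjective_naifs_def by simp
  have "h_top X I \<phi> X = h_top X I \<phi> (top_of_set X closure_of U)"
    if U: "openin (top_of_set X) U" "x \<in> U" for U
  proof (rule antisym)
    have U_sub: "U \<subseteq> top_of_set X closure_of U"
      using U(1) by (intro closure_of_subset openin_subset)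
    have sub_X: "top_of_set X closure_of U \<subseteq> X"
      using closure_of_subset_topspace[of "top_of_set X" U] by simp
    obtain r where "r > 0" "cball x r \<inter> X \<subseteq> U"
      using U openin_contains_cball by metis
    then show "h_top X I \<phi> X \<le> h_top X I \<phi> (top_of_set X closure_of U)"
      using U_sub sub_X by (intro h_top_le_near_point[OF naifs assms(3) \<open>x \<in> X\<close>, of r]) auto
    show "h_top X I \<phi> (top_of_set X closure_of U) \<le> h_top X I \<phi> X"
      using U(2) U_sub sub_X by (intro h_top_mono naifs) auto
  qed
  then show "entropy_point X I \<phi> x"
    unfolding entropy_point_def using \<open>x \<in> X\<close> by blast
qed

end
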